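(* Let $X$ be a real normed linear space, let $\Omega\subseteq X$ be a nonempty closed convex set, let $v\in X$ be nonzero, let $T(x):=\inf\{t\ge 0\mid x+tv\in\Omega\}$, and let $\bar x\in\operatorname{dom}T$. Then $$\partial T(\bar x)=\begin{cases} N(\bar x;\Omega)\cap\{x^*\in X^*\mid \langle x^*,v\rangle\ge -1\}, & \text{if } \bar x\in\Omega,\\ N(\bar x+T(\bar x)v;\Omega)\cap\{x^*\in X^*\mid \langle x^*,v\rangle=-1\}, & \text{otherwise.}\end{cases}$$ Moreover, if $\bar x\in\Omega$ and $v\in\Omega_\infty$, then $$\partial T(\bar x)=\{x^*\in X^*\mid -1\le\langle x^*,v\rangle\le 0\}\cap N(\bar x;\Omega).$$
   Context: $X^*$ is the topological dual of $X$. $T$ takes values in $[0,\infty]$ with $\inf\emptyset=\infty$, and $\operatorname{dom}T:=\{x\mid T(x)<\infty\}$; for $x\in\operatorname{dom}T$ the point $x+T(x)v$ lies in $\Omega$. Subdifferential and normal cone are those of convex analysis: $\partial T(\bar x)=\{x^*\in X^*\mid \langle x^*,x-\bar x\rangle\le T(x)-T(\bar x)\ \forall x\in X\}$ and, for $y\in\Omega$, $N(y;\Omega)=\{x^*\in X^*\mid\langle x^*,x-y\rangle\le 0\ \forall x\in\Omega\}$. The recession cone is $\Omega_\infty:=\{u\in X\mid \omega+\lambda u\in\Omega\text{ for all }\omega\in\Omega,\ \lambda\ge 0\}$. *)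

theory Defs
  imports "HOL-Analysis.Analysis"
begin

text \<open>The topological dual of \<open>'a\<close> is the type \<open>'a \<Rightarrow>\<^sub>L real\<close>; the pairing of \<open>x'\<close> with \<open>x\<close> is
  \<open>blinfun_apply x' x\<close>.\<close>

text \<open>In \<^typ>\<open>ereal\<close> the infimum of the empty set is \<open>\<infinity>\<close>.\<close>

definition min_time :: "'a::real_normed_vector \<Rightarrow> 'a set \<Rightarrow> 'a \<Rightarrow> ereal" where
  "min_time v \<Omega> x = Inf {ereal t | t. 0 \<le> t \<and> x + t *\<^sub>R v \<in> \<Omega>}"

definition effective_dom :: "('a \<Rightarrow> ereal) \<Rightarrow> 'a set" where
  "effective_dom f = {x. f x < \<infinity>}"

text \<open>Meant for \<open>f\<close> finite at the base point \<open>a\<close>: then the difference is \<open>\<infinity>\<close> exactly where \<open>f x = \<infinity>\<close>,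
  and the undetermined form \<open>\<infinity> - \<infinity>\<close> does not arise.\<close>

definition subdifferential :: "('a::real_normed_vector \<Rightarrow> ereal) \<Rightarrow> 'a \<Rightarrow> ('a \<Rightarrow>\<^sub>L real) set" where
  "subdifferential f a = {x'. \<forall>x. ereal (blinfun_apply x' (x - a)) \<le> f x - f a}"

text \<open>Meant for \<open>y \<in> \<Omega>\<close>.\<close>

definition normal_cone :: "'a::real_normed_vector \<Rightarrow> 'a set \<Rightarrow> ('a \<Rightarrow>\<^sub>L real) set" where
  "normal_cone y \<Omega> = {x'. \<forall>x\<in>\<Omega>. blinfun_apply x' (x - y) \<le> 0}"

definition recession_cone :: "'a::real_normed_vector set \<Rightarrow> 'a set" where
  "recession_cone \<Omega> = {u. \<forall>\<omega>\<in>\<Omega>. \<forall>l\<ge>0. \<omega> + l *\<^sub>R u \<in> \<Omega>}"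

end

theory Submission
  imports Defs
begin

text \<open>Every \<open>x\<close> with \<open>x + s v \<in> \<Omega>\<close> and \<open>s \<ge> 0\<close> has the form \<open>x = \<omega> - s v\<close> with \<open>\<omega> \<in> \<Omega>\<close>. Since the
  infimum defining \<open>T xbar = r\<close> is attained at \<open>w = xbar + r v \<in> \<Omega>\<close>, the subgradient inequality reads
  \<open>\<langle>x', \<omega> - w\<rangle> \<le> (s - r) (1 + \<langle>x', v\<rangle>)\<close> for all \<open>\<omega> \<in> \<Omega>\<close>, \<open>s \<ge> 0\<close>. Taking \<open>s = r\<close> gives the normal cone;
  taking \<open>\<omega> = w\<close> and varying \<open>s\<close> around \<open>r\<close> gives the constraint on \<open>\<langle>x', v\<rangle>\<close>, which is one-sided
  exactly when \<open>r = 0\<close>.\<close>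

lemma min_time_le:
  assumes "0 \<le> t" and "x + t *\<^sub>R v \<in> \<Omega>"
  shows "min_time v \<Omega> x \<le> ereal t"
  unfolding min_time_def by (rule Inf_lower) (use assms in auto)

text \<open>The admissible times form a closed subset of \<open>{0..}\<close>, as the preimage of
  \<Omega> under a continuous map, and a finite value of \<open>min_time\<close> means that this set
  is nonempty; hence it contains its infimum.\<close>

lemma min_time_attained:
  assumes "closed \<Omega>" and "x \<in> effective_dom (min_time v \<Omega>)"
  obtains r where "0 \<le> r" and "min_time v \<Omega> x = ereal r" and "x + r *\<^sub>R v \<in> \<Omega>"
proof -
  define S where "S = {t. 0 \<le> t \<and> x + t *\<^sub>R v \<in> \<Omega>}"
  have "S = {0..} \<inter> (\<lambda>t. x + t *\<^sub>R v) -` \<Omega>"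
    by (auto simp: S_def)
  then have "closed S"
    using assms(1) by (auto intro!: closed_Int closed_vimage continuous_intros)
  moreover have "bdd_below S"
    by (auto simp: S_def bdd_below_def)
  moreover have "S \<noteq> {}"
  proof
    assume "S = {}"
    then have "{ereal t | t. 0 \<le> t \<and> x + t *\<^sub>R v \<in> \<Omega>} = {}"
      by (auto simp: S_def)
    with assms(2) show False
      unfolding effective_dom_def min_time_def by (simp add: top_ereal_def)
  qed
  ultimately have r: "Inf S \<in> S"
    by (intro closed_contains_Inf)
  have "min_time v \<Omega> x = ereal (Inf S)"
  proof (rule antisym)
    show "min_time v \<Omega> x \<le> ereal (Inf S)"
      using r by (auto simp: S_def intro: min_time_le)
    show "ereal (Inf S) \<le> min_time v \<Omega> x"
      unfolding min_time_def
      by (rule Inf_greatest) (use \<open>bdd_below S\<close> in \<open>auto simp: S_def intro: cInf_lower\<close>)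
  qed
  with r show thesis
    by (intro that[of "Inf S"]) (auto simp: S_def)
qed

lemma subdifferential_min_time_iff:
  assumes "min_time v \<Omega> a = ereal r"
  shows "x' \<in> subdifferential (min_time v \<Omega>) a \<longleftrightarrow>
    (\<forall>\<omega>\<in>\<Omega>. \<forall>s\<ge>0. blinfun_apply x' (\<omega> - (a + r *\<^sub>R v)) \<le> (s - r) * (1 + blinfun_apply x' v))"
    (is "_ \<longleftrightarrow> ?R")
proof -
  \<comment> \<open>With \<open>w = a + r *\<^sub>R v\<close>, the argument on the left is
    \<open>(\<omega> - w) + (r - s) *\<^sub>R v\<close>.\<close>
  have key: "blinfun_apply x' (\<omega> - s *\<^sub>R v - a) \<le> s - r \<longleftrightarrow>
      blinfun_apply x' (\<omega> - (a + r *\<^sub>R v)) \<le> (s - r) * (1 + blinfun_apply x' v)" for \<omega> s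
    by (simp add: blinfun.diff_right blinfun.add_right blinfun.scaleR_right algebra_simps)
  have diff: "ereal c \<le> T - ereal r \<longleftrightarrow> ereal (c + r) \<le> T" for c and T :: ereal
    by (cases T) auto
  show ?thesis
  proof
    assume sub: "x' \<in> subdifferential (min_time v \<Omega>) a"
    have "blinfun_apply x' (\<omega> - s *\<^sub>R v - a) \<le> s - r" if "\<omega> \<in> \<Omega>" "0 \<le> s" for \<omega> s
    proof -
      have "ereal (blinfun_apply x' (\<omega> - s *\<^sub>R v - a) + r) \<le> min_time v \<Omega> (\<omega> - s *\<^sub>R v)"
        using sub by (simp add: subdifferential_def assms diff)
      also have "\<dots> \<le> ereal s"
        using that by (intro min_time_le) auto
      finally show ?thesis by simp
    qed
    then show ?R by (simp add: key)
  next
    assume R: ?R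
    \<comment> \<open>It suffices to bound every admissible time \<open>s\<close> from below; if
      there is none, the infimum is \<infinity> and \<open>x\<close> imposes no condition.\<close>
    have "ereal (blinfun_apply x' (x - a) + r) \<le> min_time v \<Omega> x" for x
      unfolding min_time_def
    proof (rule Inf_greatest, clarify)
      fix s :: real
      assume "0 \<le> s" "x + s *\<^sub>R v \<in> \<Omega>"
      then show "ereal (blinfun_apply x' (x - a) + r) \<le> ereal s"
        using R key[of "x + s *\<^sub>R v" s] by simp
    qed
    then show "x' \<in> subdifferential (min_time v \<Omega>) a"
      by (simp add: subdifferential_def assms diff)
  qed
qed

lemma subdifferential_min_time_in:
  assumes "a \<in> \<Omega>"
  shows "subdifferential (min_time v \<Omega>) a =
    normal_cone a \<Omega> \<inter> {x'. blinfun_apply x' v \<ge> -1}"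
proof -
  have "min_time v \<Omega> a \<le> ereal 0"
    using assms by (intro min_time_le) auto
  moreover have "ereal 0 \<le> min_time v \<Omega> a"
    unfolding min_time_def by (rule Inf_greatest) auto
  ultimately have T: "min_time v \<Omega> a = ereal 0"
    by (rule antisym)
  show ?thesis
  proof (rule set_eqI)
    fix x' :: "'a \<Rightarrow>\<^sub>L real"
    have "(\<forall>\<omega>\<in>\<Omega>. \<forall>s\<ge>0. blinfun_apply x' (\<omega> - a) \<le> s * (1 + blinfun_apply x' v)) \<longleftrightarrow>
        (\<forall>\<omega>\<in>\<Omega>. blinfun_apply x' (\<omega> - a) \<le> 0) \<and> -1 \<le> blinfun_apply x' v" (is "?L \<longleftrightarrow> ?R")
    proof
      assume L: ?L
      \<comment> \<open>The choice \<open>\<omega> = a\<close>, \<open>s = 1\<close> leaves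
        \<open>0 \<le> 1 + blinfun_apply x' v\<close>.\<close>
      have "-1 \<le> blinfun_apply x' v"
        using L[rule_format, OF assms zero_le_one] by simp
      moreover have "blinfun_apply x' (\<omega> - a) \<le> 0" if "\<omega> \<in> \<Omega>" for \<omega>
        using L[rule_format, OF that, of 0] by simp
      ultimately show ?R by blast
    next
      assume R: ?R
      then have "0 \<le> s * (1 + blinfun_apply x' v)" if "0 \<le> s" for s
        using that by simp
      with R show ?L by (meson order_trans)
    qed
    then show "x' \<in> subdifferential (min_time v \<Omega>) a \<longleftrightarrow>
        x' \<in> normal_cone a \<Omega> \<inter> {x'. blinfun_apply x' v \<ge> -1}"
      by (simp add: subdifferential_min_time_iff[OF T] normal_cone_def)
  qed
qed

lemma subdifferential_min_time_notin:
  assumes T: "min_time v \<Omega> a = ereal r" and "0 < r" and w: "a + r *\<^sub>R v \<in> \<Omega>"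
  shows "subdifferential (min_time v \<Omega>) a =
    normal_cone (a + r *\<^sub>R v) \<Omega> \<inter> {x'. blinfun_apply x' v = -1}"
proof (rule set_eqI)
  fix x'
  show "x' \<in> subdifferential (min_time v \<Omega>) a \<longleftrightarrow>
      x' \<in> normal_cone (a + r *\<^sub>R v) \<Omega> \<inter> {x'. blinfun_apply x' v = -1}"
  proof
    assume "x' \<in> subdifferential (min_time v \<Omega>) a"
    then have L: "blinfun_apply x' (\<omega> - (a + r *\<^sub>R v)) \<le> (s - r) * (1 + blinfun_apply x' v)"
      if "\<omega> \<in> \<Omega>" "0 \<le> s" for \<omega> s
      using that by (simp add: subdifferential_min_time_iff[OF T])
    \<comment> \<open>At \<omega> equal to \<open>a + r *\<^sub>R v\<close> the left side of
      \<open>L\<close> vanishes, while \<open>s = 2 * r\<close> and \<open>s = 0\<close> give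
      \<open>s - r\<close> the opposite values \<open>r\<close> and \<open>- r\<close>.\<close>
    have "0 \<le> r * (1 + blinfun_apply x' v)" and "r * (1 + blinfun_apply x' v) \<le> 0"
      using L[OF w, of "2 * r"] L[OF w, of 0] \<open>0 < r\<close> by simp_all
    then have "blinfun_apply x' v = -1"
      using \<open>0 < r\<close> by (simp add: zero_le_mult_iff mult_le_0_iff)
    moreover have "blinfun_apply x' (\<omega> - (a + r *\<^sub>R v)) \<le> 0" if "\<omega> \<in> \<Omega>" for \<omega>
      using L[OF that, of r] \<open>0 < r\<close> by simp
    ultimately show "x' \<in> normal_cone (a + r *\<^sub>R v) \<Omega> \<inter> {x'. blinfun_apply x' v = -1}"
      by (simp add: normal_cone_def)
  next
    \<comment> \<open>Now the factor \<open>1 + blinfun_apply x' v\<close> is zero, so the criterion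
      reduces to the normal cone inequality for every \<open>s\<close>.\<close>
    assume "x' \<in> normal_cone (a + r *\<^sub>R v) \<Omega> \<inter> {x'. blinfun_apply x' v = -1}"
    then show "x' \<in> subdifferential (min_time v \<Omega>) a"
      by (simp add: subdifferential_min_time_iff[OF T] normal_cone_def)
  qed
qed

text \<open>A unit step from \<open>a\<close> along \<open>u\<close> stays in \<Omega>, so the
  normal cone inequality can be tested at \<open>a + u\<close>. This supplies the upper bound in the
  recession case of the theorem.\<close>

lemma normal_cone_recession_cone_le:
  assumes "x' \<in> normal_cone a \<Omega>" and "a \<in> \<Omega>" and "u \<in> recession_cone \<Omega>"
  shows "blinfun_apply x' u \<le> 0"
proof -
  have "a + 1 *\<^sub>R u \<in> \<Omega>"
    using assms(2,3) unfolding recession_cone_def by (blast intro: zero_le_one)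
  then show ?thesis
    using assms(1) by (force simp: normal_cone_def)
qed

theorem theorem3p2:
  fixes \<Omega> :: "'a::real_normed_vector set" and v xbar :: 'a
  assumes "\<Omega> \<noteq> {}" and "closed \<Omega>" and "convex \<Omega>"
    and "v \<noteq> 0"
    and "xbar \<in> effective_dom (min_time v \<Omega>)"
  shows "subdifferential (min_time v \<Omega>) xbar =
      (if xbar \<in> \<Omega>
       then normal_cone xbar \<Omega> \<inter> {x'. blinfun_apply x' v \<ge> -1}
       else normal_cone (xbar + real_of_ereal (min_time v \<Omega> xbar) *\<^sub>R v) \<Omega>
              \<inter> {x'. blinfun_apply x' v = -1})
    \<and> (xbar \<in> \<Omega> \<and> v \<in> recession_cone \<Omega> \<longrightarrow>
      subdifferential (min_time v \<Omega>) xbar =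
        {x'. -1 \<le> blinfun_apply x' v \<and> blinfun_apply x' v \<le> 0} \<inter> normal_cone xbar \<Omega>)"
proof (cases "xbar \<in> \<Omega>")
  case True
  then show ?thesis
    using subdifferential_min_time_in[OF True, of v] normal_cone_recession_cone_le[OF _ True, of _ v]
    by auto
next
  case False
  obtain r where r: "0 \<le> r" "min_time v \<Omega> xbar = ereal r" "xbar + r *\<^sub>R v \<in> \<Omega>"
    using min_time_attained assms(2,5) by blast
  \<comment> \<open>If \<open>r\<close> were 0, the attained point would be \<open>xbar\<close>
    itself, which lies outside \<Omega>.\<close>
  with False have "0 < r"
    by (cases "r = 0") auto
  with r False show ?thesis
    by (simp add: subdifferential_min_time_notin)
qed

end
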